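(* As $n\to\infty$, $$k_0(n,3,n)\le \frac{2}{\lg(4/3)}\,(1+o(1))\lg n\qquad\text{and}\qquad k_0(n,3,3)\le \frac{2}{\lg(27/21)}\,(1+o(1))\lg n ,$$ where $2/\lg(4/3)=4.818\ldots$ and $2/\lg(27/21)=5.516\ldots$.
   Context: $\lg$ denotes $\log_2$. For a positive integer $t$, $[t]=\{1,\dots,t\}$. A word $w=w_1\cdots w_t$ of length $t$ over an alphabet induces the partition of $[t]$ in which $i$ and $j$ are in the same block iff $w_i=w_j$; two words are equivalent if they induce the same partition. For $n\ge t$, a $k\times n$ array with entries from the alphabet $\{1,\dots,d\}$ (or any $d$-letter alphabet) is a covering array for set partitions (with parameters $t,d$) if for each choice of $t$ columns, each of the $B(t)$ partitions of $[t]$ (into any number of parts, $B(t)$ being the Bell number) is induced by the word appearing in at least one of the rows of the selected $t$ columns (the columns being taken in their order from left to right). $k_0(n,t,d)$ denotes the minimum number $k$ of rows for which such a $k\times n$ array exists. In $k_0(n,3,n)$ the alphabet size equals the number $n$ of columns. The term $o(1)$ denotes a quantity tending to $0$ as $n\to\infty$. *)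

theory Defs
  imports Complex_Main "HOL-Library.Disjoint_Sets"
begin

text \<open>A word of length \<open>t\<close> is a function on positions; only its values on \<open>{1..t}\<close> matter.\<close>

definition induced_partition :: "nat \<Rightarrow> (nat \<Rightarrow> 'a) \<Rightarrow> nat set set" where
  "induced_partition t w = {1..t} // {(i, j). i \<in> {1..t} \<and> j \<in> {1..t} \<and> w i = w j}"

text \<open>The entry of the array \<open>A\<close> in row \<open>r\<close> and column \<open>j\<close> is \<open>A r j\<close>; values outside
  \<open>{1..k} \<times> {1..n}\<close> are irrelevant. A choice of \<open>t\<close> columns, read from left to right, is a
  strictly increasing map \<open>c\<close> from \<open>{1..t}\<close> to \<open>{1..n}\<close>.\<close>

definition covering_array :: "nat \<Rightarrow> nat \<Rightarrow> nat \<Rightarrow> nat \<Rightarrow> (nat \<Rightarrow> nat \<Rightarrow> nat) \<Rightarrow> bool" where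
  "covering_array k n t d A \<longleftrightarrow>
     1 \<le> t \<and> t \<le> n \<and>
     (\<forall>r\<in>{1..k}. \<forall>j\<in>{1..n}. A r j \<in> {1..d}) \<and>
     (\<forall>c. strict_mono_on {1..t} c \<and> c ` {1..t} \<subseteq> {1..n} \<longrightarrow>
        (\<forall>P. partition_on {1..t} P \<longrightarrow>
           (\<exists>r\<in>{1..k}. induced_partition t (\<lambda>i. A r (c i)) = P)))"

text \<open>This is a genuine minimum whenever some such array exists, i.e. for \<open>1 \<le> t \<le> n\<close> and
  \<open>t \<le> d\<close>; otherwise the value is unspecified.\<close>

definition k0 :: "nat \<Rightarrow> nat \<Rightarrow> nat \<Rightarrow> nat" where
  "k0 n t d = (LEAST k. \<exists>A. covering_array k n t d A)"

end

theory Submission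
  imports Defs "HOL-Library.Infinite_Set"
begin

text \<open>
  The bounds come from the probabilistic method with alterations, in a derandomised form.

  Say that a row serves a triple of columns and a partition of \<open>{1..3}\<close> if it induces that
  partition on these columns. Two of the partitions can be served on all triples at once, each by
  one additional row: a constant row induces the one-block partition everywhere, and,
  when there are as many letters as columns, the row whose entries are the column numbers induces
  the partition into singletons. With the extra rows set aside, only the three two-block
  partitions remain when the alphabet has \<open>n\<close> letters. A random word over just two of the
  letters induces a given one of them with probability \<open>2/8 = 1/4\<close>. Over three letters the
  four partitions other than the one-block partition remain, and a random word induces each of
  them with probability \<open>6/27\<close> (\<open>card_inducing_words_ge\<close>). Let \<open>p\<close> be this probability
  and \<open>q = 1 - p\<close>, so \<open>q = 3/4\<close> and \<open>q = 21/27\<close> respectively.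

  Take \<open>2n\<close> columns and choose the rows one after another. The average over all possible rows
  shows that some row induces the required partition for at least a fraction \<open>p\<close> of the pairs
  (triple of columns, partition) that are still unserved. So after \<open>k\<close> rows at most
  \<open>O(n\<^sup>3) q\<^sup>k\<close> pairs are unserved (\<open>exists_rows_by_averaging\<close>).

  It is not necessary to bring this number below \<open>1\<close>, which would cost \<open>3 lg n / lg (1/q)\<close>
  rows. As soon as at most \<open>n\<close> pairs are unserved, deleting one column from each of their
  triples leaves at least \<open>n\<close> columns on which everything is served
  (\<open>exists_columns_avoiding\<close>). This only requires \<open>O(n\<^sup>2) q\<^sup>k \<le> 1\<close>, that is,
  \<open>k = 2 lg n / lg (1/q) + O(1)\<close>, and the factor \<open>2\<close> in the theorem is this exponent of
  \<open>n\<close>.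
\<close>

section \<open>Words inducing a given partition\<close>

definition block :: "'a set set \<Rightarrow> 'a \<Rightarrow> 'a set" where
  "block P i = (THE B. B \<in> P \<and> i \<in> B)"

lemma block_eqI:
  assumes "partition_on T P" "B \<in> P" "i \<in> B"
  shows "block P i = B"
  unfolding block_def using assms
  by (intro the_equality) (auto dest!: partition_onD2 dest: disjointD)

lemma block_in:
  assumes "partition_on T P" "i \<in> T"
  shows "block P i \<in> P" "i \<in> block P i"
proof -
  obtain B where "B \<in> P" "i \<in> B"
    using assms partition_onD1 by blast
  then show "block P i \<in> P" "i \<in> block P i"
    using block_eqI[OF assms(1)] by auto
qed

lemma block_image:
  assumes "partition_on T P"
  shows "block P ` T = P"
proof
  show "block P ` T \<subseteq> P"
    using block_in(1)[OF assms] by auto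
  show "P \<subseteq> block P ` T"
  proof
    fix B assume B: "B \<in> P"
    then obtain i where i: "i \<in> B"
      using partition_onD3[OF assms] by fastforce
    then have "i \<in> T"
      using partition_onD1[OF assms] B by auto
    then show "B \<in> block P ` T"
      using block_eqI[OF assms B i] by auto
  qed
qed

lemma induced_partition_cong:
  assumes "\<And>i. i \<in> {1..t} \<Longrightarrow> v i = w i"
  shows "induced_partition t v = induced_partition t w"
proof -
  have "{(i, j). i \<in> {1..t} \<and> j \<in> {1..t} \<and> v i = v j} =
        {(i, j). i \<in> {1..t} \<and> j \<in> {1..t} \<and> w i = w j}"
    using assms by auto
  then show ?thesis
    unfolding induced_partition_def by simp
qed

text \<open>The form in which induced partitions are computed below: \<open>w\<close> induces \<open>P\<close> when
  \<open>w\<close> and the map sending each position to its block have the same fibres.\<close>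

lemma induced_partition_eqI:
  assumes P: "partition_on {1..t} P"
    and w: "\<And>i j. i \<in> {1..t} \<Longrightarrow> j \<in> {1..t} \<Longrightarrow> w i = w j \<longleftrightarrow> block P i = block P j"
  shows "induced_partition t w = P"
proof -
  have "{(i, j). i \<in> {1..t} \<and> j \<in> {1..t} \<and> w i = w j} = {(i, j). \<exists>B\<in>P. i \<in> B \<and> j \<in> B}"
  proof (intro set_eqI, clarify)
    fix i j
    have "(\<exists>B\<in>P. i \<in> B \<and> j \<in> B) \<longleftrightarrow> i \<in> {1..t} \<and> j \<in> {1..t} \<and> block P i = block P j"
    proof
      assume "\<exists>B\<in>P. i \<in> B \<and> j \<in> B"
      then obtain B where B: "B \<in> P" "i \<in> B" "j \<in> B"
        by blast
      then have "i \<in> {1..t}" "j \<in> {1..t}"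
        unfolding partition_onD1[OF P] by blast+
      then show "i \<in> {1..t} \<and> j \<in> {1..t} \<and> block P i = block P j"
        using block_eqI[OF P B(1,2)] block_eqI[OF P B(1,3)] by simp
    next
      assume ij: "i \<in> {1..t} \<and> j \<in> {1..t} \<and> block P i = block P j"
      then have "block P i \<in> P" "i \<in> block P i" "j \<in> block P i"
        using block_in[OF P, of i] block_in[OF P, of j] by simp_all
      then show "\<exists>B\<in>P. i \<in> B \<and> j \<in> B"
        by blast
    qed
    then show "(i, j) \<in> {(i, j). i \<in> {1..t} \<and> j \<in> {1..t} \<and> w i = w j} \<longleftrightarrow>
               (i, j) \<in> {(i, j). \<exists>B\<in>P. i \<in> B \<and> j \<in> B}"
      using w by auto
  qed
  then show ?thesis
    unfolding induced_partition_def using partition_on_eq_quotient[OF P] by simp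
qed

lemma card_partition_le:
  assumes "partition_on {1..t} P"
  shows "card P \<le> t"
  using card_image_le[of "{1..t}" "block P"] block_image[OF assms] by simp

lemma induced_partition_constant:
  assumes "partition_on {1..t} P" "card P = 1"
  shows "induced_partition t (\<lambda>i. a) = P"
proof (rule induced_partition_eqI[OF assms(1)])
  fix i j assume "i \<in> {1..t}" "j \<in> {1..t}"
  then have "block P i \<in> P" "block P j \<in> P"
    using block_in(1)[OF assms(1)] by auto
  then show "a = a \<longleftrightarrow> block P i = block P j"
    using assms(2) by (auto simp: card_1_singleton_iff)
qed

text \<open>If \<open>P\<close> has \<open>t\<close> blocks then the surjection \<open>block P\<close> from \<open>{1..t}\<close> onto \<open>P\<close>
  is a bijection, so its fibres, like those of \<open>w\<close>, are singletons.\<close>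

lemma induced_partition_inj:
  assumes "partition_on {1..t} P" "card P = t" "inj_on w {1..t}"
  shows "induced_partition t w = P"
proof (rule induced_partition_eqI[OF assms(1)])
  have "inj_on (block P) {1..t}"
    using block_image[OF assms(1)] assms(2) by (intro eq_card_imp_inj_on) auto
  then show "w i = w j \<longleftrightarrow> block P i = block P j" if "i \<in> {1..t}" "j \<in> {1..t}" for i j
    using that assms(3) by (simp add: inj_on_eq_iff)
qed

definition inducing_words :: "nat \<Rightarrow> 'a set \<Rightarrow> nat set set \<Rightarrow> (nat \<Rightarrow> 'a) set" where
  "inducing_words t D P = {v \<in> {1..t} \<rightarrow>\<^sub>E D. induced_partition t v = P}"

text \<open>Labelling the blocks injectively by letters of \<open>D\<close> and reading off the labels along
  \<open>1, \<dots>, t\<close> gives a word that induces \<open>P\<close>, and different labellings give different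
  words. The product on the left is the number of injective labellings.\<close>

lemma card_inducing_words_ge:
  assumes P: "partition_on {1..t} P" and D: "finite D"
  shows "(\<Prod>i = 0..<card P. card D - i) \<le> card (inducing_words t D P)"
proof -
  define F where "F = {f \<in> P \<rightarrow>\<^sub>E D. inj_on f P}"
  define word where "word = (\<lambda>f. \<lambda>i\<in>{1..t}. (f (block P i) :: 'a))"
  have finP: "finite P"
    using finite_elements[OF _ P] by simp
  have "(\<Prod>i = 0..<card P. card D - i) = card F"
    unfolding F_def using card_inj_on_subset_funcset[OF finP D, of P] by simp
  also have "\<dots> \<le> card (inducing_words t D P)"
  proof (rule card_inj_on_le)
    show "inj_on word F"
    proof (rule inj_onI)
      fix f g assume fg: "f \<in> F" "g \<in> F" "word f = word g"
      have "f (block P i) = g (block P i)" if "i \<in> {1..t}" for i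
        using fun_cong[OF fg(3), of i] that by (simp add: word_def)
      then have "\<forall>B \<in> block P ` {1..t}. f B = g B"
        by blast
      then have "f B = g B" if "B \<in> P" for B
        using that unfolding block_image[OF P] by blast
      then show "f = g"
        using fg(1,2) unfolding F_def by (auto intro: PiE_ext)
    qed
    show "word ` F \<subseteq> inducing_words t D P"
    proof (rule image_subsetI)
      fix f assume f: "f \<in> F"
      have "word f \<in> {1..t} \<rightarrow>\<^sub>E D"
        using f block_in(1)[OF P] unfolding word_def F_def by auto
      moreover have "induced_partition t (word f) = P"
      proof (rule induced_partition_eqI[OF P])
        fix i j assume "i \<in> {1..t}" "j \<in> {1..t}"
        then show "word f i = word f j \<longleftrightarrow> block P i = block P j"
          using f block_in(1)[OF P] unfolding word_def F_def by (auto simp: inj_on_eq_iff)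
      qed
      ultimately show "word f \<in> inducing_words t D P"
        unfolding inducing_words_def by simp
    qed
    show "finite (inducing_words t D P)"
      unfolding inducing_words_def by (rule finite_subset[of _ "{1..t} \<rightarrow>\<^sub>E D"]) (auto simp: D finite_PiE)
  qed
  finally show ?thesis .
qed

text \<open>Each word on the \<open>t\<close> columns chosen by \<open>c\<close> extends to a full row by an arbitrary choice
  of letters in the other columns. Hence a random row induces \<open>P\<close> on these columns at least as
  often as a random word of length \<open>t\<close> does.\<close>

lemma card_rows_inducing_ge:
  assumes I: "finite I" and D: "finite D" and c: "inj_on c {1..t}" "c ` {1..t} \<subseteq> I"
  shows "card D ^ (card I - t) * card (inducing_words t D P)
         \<le> card {w \<in> I \<rightarrow>\<^sub>E D. induced_partition t (\<lambda>i. w (c i)) = P}" (is "_ \<le> card ?R")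
proof -
  define V where "V = inducing_words t D P"
  \<comment> \<open>\<open>fiber v\<close> consists of the rows that read \<open>v\<close> in the columns \<open>c 1, \<dots>, c t\<close>.\<close>
  define fiber where
    "fiber v = (\<Pi>\<^sub>E j\<in>I. if j \<in> c ` {1..t} then {v (the_inv_into {1..t} c j)} else D)" for v :: "nat \<Rightarrow> 'b"
  have fiberD: "w (c i) = v i" if "w \<in> fiber v" "i \<in> {1..t}" for w v i
  proof -
    have cI: "c i \<in> I" and ci: "c i \<in> c ` {1..t}"
      using that(2) c(2) by blast+
    have "w (c i) \<in> (if c i \<in> c ` {1..t} then {v (the_inv_into {1..t} c (c i))} else D)"
      using that(1) cI unfolding fiber_def by (rule PiE_mem)
    then show ?thesis
      using ci the_inv_into_f_f[OF c(1) that(2)] by simp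
  qed
  have finV: "finite V"
    unfolding V_def inducing_words_def by (rule finite_subset[of _ "{1..t} \<rightarrow>\<^sub>E D"]) (auto simp: D finite_PiE)
  have finF: "finite (fiber v)" for v
    unfolding fiber_def by (intro finite_PiE I) (auto simp: D)
  have card_fiber: "card (fiber v) = card D ^ (card I - t)" for v
  proof -
    have "card (fiber v) = (\<Prod>j\<in>I. if j \<in> c ` {1..t} then 1 else card D)"
      unfolding fiber_def card_PiE[OF I] by (rule prod.cong) auto
    also have "\<dots> = card D ^ card (I - c ` {1..t})"
      using I by (simp add: prod.If_cases Diff_eq)
    also have "card (I - c ` {1..t}) = card I - t"
      using c by (simp add: card_Diff_subset card_image)
    finally show ?thesis .
  qed
  have disj: "fiber v \<inter> fiber v' = {}" if "v \<in> V" "v' \<in> V" "v \<noteq> v'" for v v'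
  proof (rule ccontr)
    assume "fiber v \<inter> fiber v' \<noteq> {}"
    then obtain w where w: "w \<in> fiber v" "w \<in> fiber v'"
      by auto
    have "v i = v' i" if "i \<in> {1..t}" for i
      using fiberD[OF w(1) that] fiberD[OF w(2) that] by simp
    moreover have "v \<in> {1..t} \<rightarrow>\<^sub>E D" "v' \<in> {1..t} \<rightarrow>\<^sub>E D"
      using \<open>v \<in> V\<close> \<open>v' \<in> V\<close> unfolding V_def inducing_words_def by simp_all
    ultimately have "v = v'"
      using PiE_ext by metis
    then show False
      using \<open>v \<noteq> v'\<close> by simp
  qed
  have "card D ^ (card I - t) * card V = card (\<Union>v\<in>V. fiber v)"
    using finV finF disj by (subst card_UN_disjoint) (auto simp: card_fiber)
  also have "\<dots> \<le> card ?R"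
  proof (rule card_mono)
    show "finite ?R"
      by (rule finite_subset[of _ "I \<rightarrow>\<^sub>E D"]) (auto simp: I D finite_PiE)
    show "(\<Union>v\<in>V. fiber v) \<subseteq> ?R"
    proof (rule UN_least, rule subsetI)
      fix v w assume v: "v \<in> V" and w: "w \<in> fiber v"
      have "induced_partition t (\<lambda>i. w (c i)) = induced_partition t v"
        by (rule induced_partition_cong) (rule fiberD[OF w])
      moreover have "w \<in> I \<rightarrow>\<^sub>E D"
      proof -
        have "(if j \<in> c ` {1..t} then {v (the_inv_into {1..t} c j)} else D) \<subseteq> D" for j
          using v c unfolding V_def inducing_words_def by (auto simp: the_inv_into_f_f)
        then have "fiber v \<subseteq> I \<rightarrow>\<^sub>E D"
          unfolding fiber_def by (intro PiE_mono)
        then show ?thesis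
          using w by (rule subsetD)
      qed
      ultimately show "w \<in> ?R"
        using v unfolding V_def inducing_words_def by simp
    qed
  qed
  finally show ?thesis
    unfolding V_def .
qed

section \<open>Averaging over rows\<close>

text \<open>Count the pairs \<open>(w, s)\<close> for which \<open>w\<close> fails to serve \<open>s\<close> in two ways. Each requirement
  \<open>s\<close> is failed by at most a fraction \<open>1 - p\<close> of the candidates, so some candidate fails at
  most a fraction \<open>1 - p\<close> of the requirements.\<close>

lemma exists_row_by_averaging:
  fixes R :: "'w \<Rightarrow> 's \<Rightarrow> bool" and p :: real
  assumes W: "finite W" "W \<noteq> {}" and U: "finite U"
    and dense: "\<And>s. s \<in> U \<Longrightarrow> p * card W \<le> card {w\<in>W. R w s}"
  shows "\<exists>w\<in>W. card {s\<in>U. \<not> R w s} \<le> (1 - p) * card U"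
proof (rule ccontr)
  assume "\<not> ?thesis"
  then have big: "(1 - p) * card U < card {s\<in>U. \<not> R w s}" if "w \<in> W" for w
    using that by auto
  have "(1 - p) * card U * card W = (\<Sum>w\<in>W. (1 - p) * card U)"
    by simp
  also have "\<dots> < (\<Sum>w\<in>W. real (card {s\<in>U. \<not> R w s}))"
    using W big by (intro sum_strict_mono) auto
  also have "\<dots> = real (\<Sum>s\<in>U. card {w\<in>W. \<not> R w s})"
    unfolding of_nat_sum[symmetric]
    using sum_multicount_gen[OF W(1) U, of "\<lambda>w s. \<not> R w s" "\<lambda>s. card {w\<in>W. \<not> R w s}"] by simp
  also have "\<dots> \<le> (\<Sum>s\<in>U. (1 - p) * card W)"
    unfolding of_nat_sum
  proof (rule sum_mono)
    fix s assume "s \<in> U"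
    have "{w\<in>W. \<not> R w s} = W - {w\<in>W. R w s}"
      by auto
    then have "real (card {w\<in>W. \<not> R w s}) = real (card W) - card {w\<in>W. R w s}"
      using W by (simp add: card_Diff_subset card_mono of_nat_diff)
    then show "real (card {w\<in>W. \<not> R w s}) \<le> (1 - p) * card W"
      using dense[OF \<open>s \<in> U\<close>] by (simp add: algebra_simps)
  qed
  finally show False
    by (simp add: algebra_simps)
qed

text \<open>The density hypothesis is inherited by every subset of \<open>S\<close>, so the averaging step can be
  repeated on the requirements that are still unserved; each new row shrinks their number by the
  factor \<open>1 - p\<close>.\<close>

lemma exists_rows_by_averaging:
  fixes R :: "'w \<Rightarrow> 's \<Rightarrow> bool" and p :: real
  assumes W: "finite W" "W \<noteq> {}" and S: "finite S" and p: "p \<le> 1"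
    and dense: "\<And>s. s \<in> S \<Longrightarrow> p * card W \<le> card {w\<in>W. R w s}"
  shows "\<exists>f. (\<forall>r. f r \<in> W) \<and>
           card {s\<in>S. \<forall>r\<in>{1..k::nat}. \<not> R (f r) s} \<le> (1 - p) ^ k * card S"
proof (induction k)
  case 0
  obtain w where "w \<in> W"
    using W by auto
  then show ?case
    by (intro exI[of _ "\<lambda>_. w"]) auto
next
  case (Suc k)
  then obtain f where f: "\<And>r. f r \<in> W"
    and bound: "card {s\<in>S. \<forall>r\<in>{1..k}. \<not> R (f r) s} \<le> (1 - p) ^ k * card S"
    by auto
  define U where "U = {s\<in>S. \<forall>r\<in>{1..k}. \<not> R (f r) s}"
  obtain w where w: "w \<in> W" "card {s\<in>U. \<not> R w s} \<le> (1 - p) * card U"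
    using exists_row_by_averaging[of W U p R] W S dense unfolding U_def by auto
  define g where "g = f(Suc k := w)"
  have "{s\<in>S. \<forall>r\<in>{1..Suc k}. \<not> R (g r) s} = {s\<in>U. \<not> R w s}"
    unfolding U_def g_def by (auto simp: atLeastAtMostSuc_conv)
  then have "card {s\<in>S. \<forall>r\<in>{1..Suc k}. \<not> R (g r) s} \<le> (1 - p) * card U"
    using w by simp
  also have "\<dots> \<le> (1 - p) * ((1 - p) ^ k * card S)"
    using bound p unfolding U_def by (intro mult_left_mono) auto
  finally show ?case
    using f w by (intro exI[of _ g]) (auto simp: g_def)
qed

section \<open>Deleting columns\<close>

text \<open>The alteration step: removing the first column of each bad choice \<open>c \<in> B\<close> destroys all of
  them and keeps at least \<open>n\<close> of the \<open>2n\<close> columns. The map \<open>e\<close> renumbers surviving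
  columns from left to right, so that increasing choices of columns stay increasing.\<close>

lemma exists_columns_avoiding:
  fixes B :: "(nat \<Rightarrow> nat) set"
  assumes "finite B" "card B \<le> n" "1 \<le> t"
  shows "\<exists>e. strict_mono_on {1..n} e \<and> e ` {1..n} \<subseteq> {1..2 * n} \<and>
             (\<forall>c\<in>B. \<not> c ` {1..t} \<subseteq> e ` {1..n})"
proof -
  define J where "J = {1..2 * n} - (\<lambda>c. c 1) ` B"
  have "2 * n - card B \<le> card J"
  proof -
    have "card {1..2 * n} - card ((\<lambda>c. c 1) ` B) \<le> card J"
      unfolding J_def using assms(1) by (intro diff_card_le_card_Diff) auto
    then show ?thesis
      using card_image_le[OF assms(1), of "\<lambda>c. c 1"] by simp
  qed
  then have J: "n \<le> card J"
    using assms(2) by linarith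
  obtain h where h: "bij_betw h {..<card J} J" "strict_mono_on {..<card J} h"
    by (rule ex_bij_betw_strict_mono_card[of J]) (simp add: J_def)
  \<comment> \<open>Columns are numbered from \<open>1\<close>, the enumeration \<open>h\<close> starts at \<open>0\<close>.\<close>
  define e where "e i = h (i - 1)" for i
  have "strict_mono_on {1..n} e"
  proof (rule strict_mono_onI)
    fix i j assume "i \<in> {1..n}" "j \<in> {1..n}" "i < j"
    then show "e i < e j"
      using J unfolding e_def by (intro strict_mono_onD[OF h(2)]) auto
  qed
  moreover have eJ: "e ` {1..n} \<subseteq> J"
  proof (rule image_subsetI)
    fix i assume "i \<in> {1..n}"
    then have "i - 1 \<in> {..<card J}"
      using J by auto
    then show "e i \<in> J"
      unfolding e_def by (rule bij_betw_apply[OF h(1)])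
  qed
  moreover have "\<not> c ` {1..t} \<subseteq> e ` {1..n}" if "c \<in> B" for c
  proof
    assume "c ` {1..t} \<subseteq> e ` {1..n}"
    moreover have "1 \<in> {1..t}"
      using assms(3) by simp
    ultimately have "c 1 \<in> J"
      using eJ by blast
    then show False
      using that unfolding J_def by auto
  qed
  moreover have "J \<subseteq> {1..2 * n}"
    unfolding J_def by auto
  ultimately show ?thesis
    by blast
qed

text \<open>The averaging argument is applied to the pairs of a choice of \<open>t\<close> among \<open>2n\<close> columns and a
  partition in \<open>Q\<close>. There are at most \<open>(2n)\<^sup>t card Q\<close> such pairs, so the hypothesis on \<open>k\<close>
  says that at most \<open>n\<close> of them remain unserved after \<open>k\<close> rows, which is what the
  alteration step can absorb.\<close>

lemma exists_array_inducing:
  fixes p :: real and n t d k :: nat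
  assumes t: "1 \<le> t" "t \<le> n" and d: "1 \<le> d" and Q: "finite Q" and p: "p \<le> 1"
    and dense: "\<And>P. P \<in> Q \<Longrightarrow> p * d ^ t \<le> card (inducing_words t {1..d} P)"
    and k: "(1 - p) ^ k * (card Q * (2 * real n) ^ t) \<le> n"
  shows "\<exists>A. (\<forall>r. \<forall>j\<in>{1..n}. A r j \<in> {1..d}) \<and>
     (\<forall>c. strict_mono_on {1..t} c \<and> c ` {1..t} \<subseteq> {1..n} \<longrightarrow>
        (\<forall>P\<in>Q. \<exists>r\<in>{1..k}. induced_partition t (\<lambda>i. A r (c i)) = P))"
proof -
  define W where "W = {1..2 * n} \<rightarrow>\<^sub>E {1..d}"
  define C where "C = {c \<in> {1..t} \<rightarrow>\<^sub>E {1..2 * n}. strict_mono_on {1..t} c}"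
  define R where "R w s \<longleftrightarrow> induced_partition t (\<lambda>i. w (fst s i)) = snd s"
    for w :: "nat \<Rightarrow> nat" and s :: "(nat \<Rightarrow> nat) \<times> nat set set"
  have W: "finite W" "W \<noteq> {}"
    unfolding W_def using d by (simp_all add: finite_PiE PiE_eq_empty_iff)
  have cardW: "card W = d ^ (2 * n)"
    unfolding W_def by (simp add: card_funcsetE)
  have C: "finite C" "card C \<le> (2 * n) ^ t"
  proof -
    have sub: "C \<subseteq> {1..t} \<rightarrow>\<^sub>E {1..2 * n}"
      unfolding C_def by auto
    show "finite C"
      by (rule finite_subset[OF sub]) (auto simp: finite_PiE)
    have "card C \<le> card ({1..t} \<rightarrow>\<^sub>E {1..2 * n})"
      by (rule card_mono[OF _ sub]) (auto simp: finite_PiE)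
    then show "card C \<le> (2 * n) ^ t"
      by (simp add: card_funcsetE)
  qed
  have S_dense: "p * card W \<le> card {w\<in>W. R w s}" if "s \<in> C \<times> Q" for s
  proof -
    obtain c P where s: "s = (c, P)" "c \<in> C" "P \<in> Q"
      using \<open>s \<in> C \<times> Q\<close> by auto
    have c: "inj_on c {1..t}" "c ` {1..t} \<subseteq> {1..2 * n}"
      using s(2) strict_mono_on_imp_inj_on[of "{1..t}" c] unfolding C_def by auto
    have "d ^ (2 * n) = d ^ (2 * n - t) * d ^ t"
      using t by (simp flip: power_add)
    then have "p * card W = real (d ^ (2 * n - t)) * (p * d ^ t)"
      unfolding cardW by simp
    also have "\<dots> \<le> real (d ^ (2 * n - t)) * card (inducing_words t {1..d} P)"
      using dense[OF s(3)] by (intro mult_left_mono) auto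
    also have "\<dots> \<le> card {w\<in>W. R w s}"
      using card_rows_inducing_ge[of "{1..2 * n}" "{1..d}" c t P] c
      unfolding W_def R_def s(1) of_nat_mult[symmetric] of_nat_le_iff by simp
    finally show ?thesis .
  qed
  have "\<exists>f. (\<forall>r. f r \<in> W) \<and>
      card {s \<in> C \<times> Q. \<forall>r\<in>{1..k}. \<not> R (f r) s} \<le> (1 - p) ^ k * card (C \<times> Q)"
    by (rule exists_rows_by_averaging[OF W finite_cartesian_product[OF C(1) Q] p]) (rule S_dense)
  then obtain f where f: "\<And>r. f r \<in> W"
    and few: "card {s \<in> C \<times> Q. \<forall>r\<in>{1..k}. \<not> R (f r) s} \<le> (1 - p) ^ k * card (C \<times> Q)"
    by blast
  define U where "U = {s \<in> C \<times> Q. \<forall>r\<in>{1..k}. \<not> R (f r) s}"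
  have finU: "finite U"
    unfolding U_def using C Q by simp
  have "real (card U) \<le> (1 - p) ^ k * card (C \<times> Q)"
    using few unfolding U_def .
  also have "\<dots> \<le> (1 - p) ^ k * (card Q * (2 * real n) ^ t)"
  proof (rule mult_left_mono)
    have "card (C \<times> Q) \<le> card Q * (2 * n) ^ t"
      using C by (simp add: card_cartesian_product)
    then have "real (card (C \<times> Q)) \<le> real (card Q * (2 * n) ^ t)"
      by (simp only: of_nat_le_iff)
    then show "real (card (C \<times> Q)) \<le> card Q * (2 * real n) ^ t"
      by simp
  qed (use p in auto)
  finally have "card U \<le> n"
    using k by linarith
  then have "card (fst ` U) \<le> n"
    using card_image_le[OF finU, of fst] by linarith
  from exists_columns_avoiding[OF finite_imageI[OF finU] this t(1)]
  obtain e where e: "strict_mono_on {1..n} e" "e ` {1..n} \<subseteq> {1..2 * n}"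
    and avoid: "\<forall>c \<in> fst ` U. \<not> c ` {1..t} \<subseteq> e ` {1..n}"
    by (elim exE conjE) (rule that)
  define A where "A r j = f r (e j)" for r j
  have "A r j \<in> {1..d}" if "j \<in> {1..n}" for r j
  proof -
    have "e j \<in> {1..2 * n}"
      using e(2) that by blast
    then show ?thesis
      unfolding A_def by (rule PiE_mem[OF f[of r, unfolded W_def]])
  qed
  moreover have "\<exists>r\<in>{1..k}. induced_partition t (\<lambda>i. A r (c i)) = P"
    if c: "strict_mono_on {1..t} c" "c ` {1..t} \<subseteq> {1..n}" and P: "P \<in> Q" for c P
  proof -
    define c' where "c' = (\<lambda>i\<in>{1..t}. e (c i))"
    have img: "c' ` {1..t} \<subseteq> e ` {1..n}"
      using c(2) unfolding c'_def by auto
    have "strict_mono_on {1..t} c'"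
    proof (rule strict_mono_onI)
      fix i j assume ij: "i \<in> {1..t}" "j \<in> {1..t}" "i < j"
      then have "c i < c j"
        using strict_mono_onD[OF c(1)] by blast
      moreover have "c i \<in> {1..n}" "c j \<in> {1..n}"
        using ij c(2) by blast+
      ultimately have "e (c i) < e (c j)"
        by (intro strict_mono_onD[OF e(1)])
      then show "c' i < c' j"
        using ij unfolding c'_def by simp
    qed
    moreover have "c' \<in> {1..t} \<rightarrow>\<^sub>E {1..2 * n}"
      using c(2) e(2) unfolding c'_def by auto
    ultimately have "(c', P) \<in> C \<times> Q"
      using P unfolding C_def by simp
    moreover have "(c', P) \<notin> U"
    proof
      assume "(c', P) \<in> U"
      then have "fst (c', P) \<in> fst ` U"
        by (rule imageI)
      then show False
        using bspec[OF avoid] img by simp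
    qed
    ultimately obtain r where r: "r \<in> {1..k}" "R (f r) (c', P)"
      unfolding U_def by auto
    have "induced_partition t (\<lambda>i. A r (c i)) = induced_partition t (\<lambda>i. f r (c' i))"
      by (rule induced_partition_cong) (simp add: A_def c'_def)
    then show ?thesis
      using r unfolding R_def by auto
  qed
  ultimately show ?thesis
    by blast
qed

section \<open>Triples of columns\<close>

lemma k0_le:
  assumes "covering_array k n t d A"
  shows "k0 n t d \<le> k"
  unfolding k0_def using assms by (intro Least_le) blast

lemma card_partition_of_triple:
  assumes "partition_on {1..3::nat} P"
  shows "card P = 1 \<or> card P = 2 \<or> card P = 3"
proof -
  have "card P \<le> 3"
    using card_partition_le[of 3 P] assms by simp
  moreover have "card P \<noteq> 0"
    using finite_elements[OF _ assms] partition_onD1[OF assms] by auto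
  ultimately show ?thesis
    by linarith
qed

text \<open>The array found by averaging uses only the letters \<open>1\<close> and \<open>2\<close> and serves the two-block
  partitions. Row \<open>k + 1\<close> is constant and row \<open>k + 2\<close> has pairwise distinct entries, which
  serves the other two partitions.\<close>

lemma k0_triples_own_alphabet_le:
  assumes n: "3 \<le> n"
    and k: "(3 / 4) ^ k * (card {P. partition_on {1..3::nat} P} * (2 * real n) ^ 3) \<le> n"
  shows "k0 n 3 n \<le> k + 2"
proof -
  define Q where "Q = {P. partition_on {1..3::nat} P \<and> card P = 2}"
  have fin: "finite {P. partition_on {1..3::nat} P}"
    by (rule finitely_many_partition_on) simp
  have Q: "finite Q" "card Q \<le> card {P. partition_on {1..3::nat} P}"
    unfolding Q_def by (rule finite_subset[OF _ fin], blast) (rule card_mono[OF fin], blast)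
  have dense: "1 / 4 * real (2 ^ 3) \<le> card (inducing_words 3 {1..2::nat} P)" if "P \<in> Q" for P
    using card_inducing_words_ge[of 3 P "{1..2::nat}"] that unfolding Q_def
    by (simp add: numeral_2_eq_2)
  have "(1 - 1 / 4) ^ k * (card Q * (2 * real n) ^ 3) \<le>
      (3 / 4) ^ k * (card {P. partition_on {1..3::nat} P} * (2 * real n) ^ 3)"
    using Q(2) by (simp add: mult_left_mono mult_right_mono)
  also note k
  finally have "(1 - 1 / 4) ^ k * (card Q * (2 * real n) ^ 3) \<le> n" .
  from exists_array_inducing[OF _ n _ Q(1) _ dense this]
  obtain A where A: "\<forall>r. \<forall>j\<in>{1..n}. A r j \<in> {1..2::nat}"
    and ind: "\<forall>c. strict_mono_on {1..3} c \<and> c ` {1..3} \<subseteq> {1..n} \<longrightarrow>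
        (\<forall>P\<in>Q. \<exists>r\<in>{1..k}. induced_partition 3 (\<lambda>i. A r (c i)) = P)"
    by auto
  define A' where "A' r j = (if r \<le> k then A r j else if r = k + 1 then 1 else j)" for r j
  have "covering_array (k + 2) n 3 n A'"
    unfolding covering_array_def
  proof (intro conjI ballI allI impI)
    fix r j assume "r \<in> {1..k + 2}" "j \<in> {1..n}"
    then show "A' r j \<in> {1..n}"
      using A[rule_format, of j r] n unfolding A'_def by auto
  next
    fix c :: "nat \<Rightarrow> nat" and P
    assume c: "strict_mono_on {1..3} c \<and> c ` {1..3} \<subseteq> {1..n}"
      and P: "partition_on {1..3::nat} P"
    from card_partition_of_triple[OF P]
    show "\<exists>r\<in>{1..k + 2}. induced_partition 3 (\<lambda>i. A' r (c i)) = P"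
    proof (elim disjE)
      assume "card P = 1"
      then have "induced_partition 3 (\<lambda>i. A' (k + 1) (c i)) = P"
        unfolding A'_def using induced_partition_constant[OF P] by simp
      then show ?thesis
        by (rule bexI) simp
    next
      assume "card P = 2"
      then have "P \<in> Q"
        using P unfolding Q_def by simp
      from ind[rule_format, OF c this]
      obtain r where r: "r \<in> {1..k}" and "induced_partition 3 (\<lambda>i. A r (c i)) = P"
        by (elim bexE)
      then have "induced_partition 3 (\<lambda>i. A' r (c i)) = P"
        unfolding A'_def by simp
      then show ?thesis
        by (rule bexI) (use r in simp)
    next
      assume "card P = 3"
      moreover have "inj_on c {1..3}"
        using c strict_mono_on_imp_inj_on by blast
      ultimately have "induced_partition 3 (\<lambda>i. A' (k + 2) (c i)) = P"
        unfolding A'_def using induced_partition_inj[OF P] by simp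
      then show ?thesis
        by (rule bexI) simp
    qed
  qed (use n in auto)
  then show ?thesis
    by (rule k0_le)
qed

text \<open>With three letters and more than three columns no row has distinct entries on every triple,
  so the partition into singletons is left to the averaging argument, where it is as frequent as the two-block
  partitions. Only the constant row is added: the one-block partition is induced by just
  \<open>3\<close> of the \<open>27\<close> words, so leaving it to the averaging as well would worsen the base of the
  decay to \<open>24/27\<close>.\<close>

lemma k0_triples_three_letters_le:
  assumes n: "3 \<le> n"
    and k: "(21 / 27) ^ k * (card {P. partition_on {1..3::nat} P} * (2 * real n) ^ 3) \<le> n"
  shows "k0 n 3 3 \<le> k + 1"
proof -
  define Q where "Q = {P. partition_on {1..3::nat} P \<and> card P \<in> {2, 3}}"
  have fin: "finite {P. partition_on {1..3::nat} P}"
    by (rule finitely_many_partition_on) simp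
  have Q: "finite Q" "card Q \<le> card {P. partition_on {1..3::nat} P}"
    unfolding Q_def by (rule finite_subset[OF _ fin], blast) (rule card_mono[OF fin], blast)
  have dense: "6 / 27 * real (3 ^ 3) \<le> card (inducing_words 3 {1..3::nat} P)" if "P \<in> Q" for P
    using card_inducing_words_ge[of 3 P "{1..3::nat}"] that unfolding Q_def
    by (auto simp: numeral_2_eq_2 numeral_3_eq_3)
  have "(1 - 6 / 27) ^ k * (card Q * (2 * real n) ^ 3) \<le>
      (21 / 27) ^ k * (card {P. partition_on {1..3::nat} P} * (2 * real n) ^ 3)"
    using Q(2) by (simp add: mult_left_mono mult_right_mono)
  also note k
  finally have "(1 - 6 / 27) ^ k * (card Q * (2 * real n) ^ 3) \<le> n" .
  from exists_array_inducing[OF _ n _ Q(1) _ dense this]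
  obtain A where A: "\<forall>r. \<forall>j\<in>{1..n}. A r j \<in> {1..3::nat}"
    and ind: "\<forall>c. strict_mono_on {1..3} c \<and> c ` {1..3} \<subseteq> {1..n} \<longrightarrow>
        (\<forall>P\<in>Q. \<exists>r\<in>{1..k}. induced_partition 3 (\<lambda>i. A r (c i)) = P)"
    by auto
  define A' where "A' r j = (if r \<le> k then A r j else 1)" for r j
  have "covering_array (k + 1) n 3 3 A'"
    unfolding covering_array_def
  proof (intro conjI ballI allI impI)
    fix r j assume "r \<in> {1..k + 1}" "j \<in> {1..n}"
    then show "A' r j \<in> {1..3}"
      using A[rule_format, of j r] unfolding A'_def by auto
  next
    fix c :: "nat \<Rightarrow> nat" and P
    assume c: "strict_mono_on {1..3} c \<and> c ` {1..3} \<subseteq> {1..n}"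
      and P: "partition_on {1..3::nat} P"
    show "\<exists>r\<in>{1..k + 1}. induced_partition 3 (\<lambda>i. A' r (c i)) = P"
    proof (cases "card P = 1")
      case True
      then have "induced_partition 3 (\<lambda>i. A' (k + 1) (c i)) = P"
        unfolding A'_def using induced_partition_constant[OF P] by simp
      then show ?thesis
        by (rule bexI) simp
    next
      case False
      then have "P \<in> Q"
        using P card_partition_of_triple[OF P] unfolding Q_def by simp
      from ind[rule_format, OF c this]
      obtain r where r: "r \<in> {1..k}" and "induced_partition 3 (\<lambda>i. A r (c i)) = P"
        by (elim bexE)
      then have "induced_partition 3 (\<lambda>i. A' r (c i)) = P"
        unfolding A'_def by simp
      then show ?thesis
        by (rule bexI) (use r in simp)
    qed
  qed (use n in auto)
  then show ?thesis
    by (rule k0_le)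
qed

section \<open>Asymptotics\<close>

text \<open>The condition on \<open>k\<close> holds once \<open>x\<^sup>k\<close> is at least a constant multiple of
  \<open>n\<^sup>2\<close>, so \<open>k = 2 lg n / lg x + O(1)\<close> suffices. The additive constant is absorbed into
  \<open>\<epsilon>\<close>, because \<open>lg n\<close> tends to infinity.\<close>

lemma asymptotic_bound_of_decay:
  fixes g :: "nat \<Rightarrow> nat" and x :: real and N m :: nat
  assumes x: "1 < x"
    and g: "\<And>n k. 3 \<le> n \<Longrightarrow> (1 / x) ^ k * (N * (2 * real n) ^ 3) \<le> n \<Longrightarrow> g n \<le> k + m"
  shows "\<exists>\<epsilon> :: nat \<Rightarrow> real. \<epsilon> \<longlonglongrightarrow> 0 \<and>
      (\<forall>\<^sub>F n in sequentially. real (g n) \<le> 2 / log 2 x * (1 + \<epsilon> n) * log 2 (real n))"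
proof -
  \<comment> \<open>The summand \<open>1\<close> keeps \<open>K\<close> positive, and its logarithm meaningful, when \<open>N = 0\<close>.\<close>
  define K :: real where "K = 8 * (N + 1)"
  define L where "L = log 2 x"
  define C where "C = log 2 K / L + 1 + m"
  have L: "0 < L"
    unfolding L_def using x by simp
  have K: "0 < K"
    unfolding K_def by simp
  have bound: "real (g n) \<le> 2 / L * log 2 n + C" if n: "3 \<le> n" for n
  proof -
    define y where "y = log x (K * real n ^ 2)"
    define k where "k = nat \<lceil>y\<rceil>"
    have "1 \<le> K * real n ^ 2"
      using n mult_mono[of 1 K 1 "real n ^ 2"] unfolding K_def by simp
    then have y0: "0 \<le> y"
      unfolding y_def using x by simp
    have "K * real n ^ 2 = x powr y"
      unfolding y_def using x K n by simp
    also have "\<dots> \<le> x powr real k"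
      using x unfolding k_def by (intro powr_mono) linarith+
    also have "\<dots> = x ^ k"
      using x by (simp add: powr_realpow)
    finally have xk: "K * real n ^ 2 \<le> x ^ k" .
    have "N * (2 * real n) ^ 3 \<le> K * real n ^ 2 * n"
      unfolding K_def by (simp add: power2_eq_square power3_eq_cube algebra_simps)
    also have "\<dots> \<le> x ^ k * n"
      using xk by (intro mult_right_mono) auto
    finally have "(1 / x) ^ k * (N * (2 * real n) ^ 3) \<le> n"
      using x by (simp add: power_divide field_simps)
    then have "real (g n) \<le> k + m"
      using g[OF n, of k] by linarith
    also have "\<dots> \<le> y + 1 + m"
      using y0 unfolding k_def by linarith
    also have "y = (log 2 K + 2 * log 2 n) / L"
      using K n x unfolding y_def L_def
      by (simp add: log_mult log_nat_power log_base_change[of 2 x]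
          add_divide_distrib)
    finally show ?thesis
      unfolding C_def by (simp add: add_divide_distrib)
  qed
  define \<epsilon> where "\<epsilon> n = C * L / 2 / log 2 (real n)" for n
  have lim: "filterlim (\<lambda>n. log 2 (real n)) at_top sequentially"
    unfolding log_def divide_inverse mult.commute[of "ln (real _)"]
    by (intro filterlim_tendsto_pos_mult_at_top[OF tendsto_const]
        filterlim_compose[OF ln_at_top filterlim_real_sequentially]) simp
  have "\<epsilon> \<longlonglongrightarrow> 0"
    unfolding \<epsilon>_def by (rule tendsto_divide_0[OF tendsto_const filterlim_at_top_imp_at_infinity[OF lim]])
  moreover have "\<forall>\<^sub>F n in sequentially. real (g n) \<le> 2 / L * (1 + \<epsilon> n) * log 2 (real n)"
    using eventually_ge_at_top[of 3]
  proof eventually_elim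
    case (elim n)
    then have "0 < log 2 (real n)"
      by simp
    then have "2 / L * (1 + \<epsilon> n) * log 2 (real n) = 2 / L * log 2 n + C"
      using L unfolding \<epsilon>_def by (simp add: field_simps)
    then show ?case
      using bound[OF elim] by simp
  qed
  ultimately show ?thesis
    unfolding L_def by blast
qed

text \<open>Since \<open>2 = log 2 4\<close>, the quotient \<open>2 / log 2 x\<close> is the logarithm of \<open>4\<close> to base \<open>x\<close>,
  and comparing it with a fraction amounts to comparing powers of \<open>x\<close> and \<open>4\<close>.\<close>

lemma two_div_log_bounds:
  fixes x :: real
  assumes x: "1 < x" and lower: "x ^ a \<le> 4 ^ b" and upper: "4 ^ b' < x ^ a'" and pos: "0 < b" "0 < b'"
  shows "real a / b \<le> 2 / log 2 x" "2 / log 2 x < real a' / b'"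
proof -
  have log4: "log 2 (4 ^ m) = 2 * real m" for m
    by (simp add: log_nat_power log_pow_cancel[of 2 2, simplified] power2_eq_square flip: power_mult)
  have "a * log 2 x \<le> 2 * b"
    using lower x by (simp flip: log4 log_nat_power)
  then show "real a / b \<le> 2 / log 2 x"
    using x pos by (simp add: field_simps)
  have "2 * b' < a' * log 2 x"
    using upper x by (simp flip: log4 log_nat_power)
  then show "2 / log 2 x < real a' / b'"
    using x pos by (simp add: field_simps)
qed

theorem theorem2p4:
  "(\<exists>\<epsilon> :: nat \<Rightarrow> real. \<epsilon> \<longlonglongrightarrow> 0 \<and>
      (\<forall>\<^sub>F n in sequentially.
         real (k0 n 3 n) \<le> 2 / log 2 (4 / 3) * (1 + \<epsilon> n) * log 2 (real n))) \<and>
   (\<exists>\<epsilon> :: nat \<Rightarrow> real. \<epsilon> \<longlonglongrightarrow> 0 \<and>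
      (\<forall>\<^sub>F n in sequentially.
         real (k0 n 3 3) \<le> 2 / log 2 (27 / 21) * (1 + \<epsilon> n) * log 2 (real n))) \<and>
   2 / log 2 (4 / 3) \<in> {4.818 ..< 4.819 :: real} \<and>
   2 / log 2 (27 / 21) \<in> {5.516 ..< 5.517 :: real}"
proof (intro conjI)
  show "\<exists>\<epsilon> :: nat \<Rightarrow> real. \<epsilon> \<longlonglongrightarrow> 0 \<and>
      (\<forall>\<^sub>F n in sequentially.
         real (k0 n 3 n) \<le> 2 / log 2 (4 / 3) * (1 + \<epsilon> n) * log 2 (real n))"
    by (rule asymptotic_bound_of_decay) (auto intro!: k0_triples_own_alphabet_le)
  show "\<exists>\<epsilon> :: nat \<Rightarrow> real. \<epsilon> \<longlonglongrightarrow> 0 \<and>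
      (\<forall>\<^sub>F n in sequentially.
         real (k0 n 3 3) \<le> 2 / log 2 (27 / 21) * (1 + \<epsilon> n) * log 2 (real n))"
    by (rule asymptotic_bound_of_decay) (auto intro!: k0_triples_three_letters_le)
  \<comment> \<open>The exponents come from the rational approximations \<open>53/11\<close> and \<open>612/127\<close>, and below
    \<open>171/31\<close> and \<open>331/60\<close>, which lie inside the claimed intervals and have small
    denominators.\<close>
  have "(4 / 3 :: real) ^ 53 \<le> 4 ^ 11" "4 ^ 127 < (4 / 3 :: real) ^ 612"
    by (simp_all add: power_divide)
  from two_div_log_bounds[OF _ this] show "2 / log 2 (4 / 3) \<in> {4.818 ..< 4.819 :: real}"
    by simp
  have "(27 / 21 :: real) ^ 171 \<le> 4 ^ 31" "4 ^ 60 < (27 / 21 :: real) ^ 331"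
    by (simp_all add: power_divide)
  from two_div_log_bounds[OF _ this] show "2 / log 2 (27 / 21) \<in> {5.516 ..< 5.517 :: real}"
    by simp
qed

end
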